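(* Let $n$ be a cardinal with $3\leq n\leq\omega$. Then every $\mathbf{MD}_n$ poset has an $(\omega,n)$-representation.
   Context: For a cardinal $\alpha\geq 3$, a poset $P$ is $\mathbf{MD}_\alpha$ if whenever $\{a\}\cup X\subseteq P$, $|X|<\alpha$ and $a\wedge\bigvee X$ is defined in $P$, then $\bigvee_{x\in X}(a\wedge x)$ is also defined in $P$ (in particular each $a\wedge x$ exists) and the two are equal. For cardinals $\alpha,\beta$, a poset $P$ is $(\alpha,\beta)$-representable (has an $(\alpha,\beta)$-representation) if there is an order embedding $h:P\to F$, where $F$ is a powerset algebra (the full powerset of some set, with union and intersection), such that $h$ preserves those meets existing in $P$ of sets with cardinality strictly less than $\alpha$, and those joins existing in $P$ of sets with cardinality strictly less than $\beta$. *)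

theory Defs
  imports "HOL-Algebra.Order" "HOL-Library.FuncSet"
begin

unbundle cardinal_syntax

text \<open>
  Posets are records satisfying \<^locale>\<open>partial_order\<close>. The join and the meet of
  \<open>X\<close> are the elements determined by \<open>least P _ (Upper P X)\<close> and
  \<open>greatest P _ (Lower P X)\<close>; stated relationally, so that existence is explicit.
  Cardinals are relations satisfying \<^const>\<open>Card_order\<close>.
\<close>

abbreviation is_join :: "('a, 'r) gorder_scheme \<Rightarrow> 'a \<Rightarrow> 'a set \<Rightarrow> bool"
  where "is_join P j X \<equiv> least P j (Upper P X)"

abbreviation is_meet :: "('a, 'r) gorder_scheme \<Rightarrow> 'a \<Rightarrow> 'a set \<Rightarrow> bool"
  where "is_meet P m X \<equiv> greatest P m (Lower P X)"

definition MD :: "'c rel \<Rightarrow> ('a, 'r) gorder_scheme \<Rightarrow> bool"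
  where "MD \<alpha> P \<longleftrightarrow>
    (\<forall>a X j m. a \<in> carrier P \<longrightarrow> X \<subseteq> carrier P \<longrightarrow> |X| <o \<alpha> \<longrightarrow>
       is_join P j X \<longrightarrow> is_meet P m {a, j} \<longrightarrow>
         (\<forall>x\<in>X. \<exists>c. is_meet P c {a, x}) \<and>
         is_join P m {c. \<exists>x\<in>X. is_meet P c {a, x}})"

abbreviation powerset_algebra :: "'s set \<Rightarrow> 's set gorder"
  where "powerset_algebra S \<equiv> \<lparr>carrier = Pow S, eq = (=), le = (\<subseteq>)\<rparr>"

text \<open>
  The empty set counts as a set of cardinality below \<open>\<alpha>\<close> or \<open>\<beta>\<close> (if these are nonzero): a
  top element, when there is one, is sent to the empty intersection \<open>S\<close>, and a bottom
  element to the empty union.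
\<close>

definition representation ::
    "'c rel \<Rightarrow> 'd rel \<Rightarrow> ('a, 'r) gorder_scheme \<Rightarrow> 's set \<Rightarrow> ('a \<Rightarrow> 's set) \<Rightarrow> bool"
  where "representation \<alpha> \<beta> P S h \<longleftrightarrow>
    h \<in> carrier P \<rightarrow> Pow S \<and>
    order_emb P (powerset_algebra S) h \<and>
    (\<forall>X m. X \<subseteq> carrier P \<longrightarrow> |X| <o \<alpha> \<longrightarrow> is_meet P m X \<longrightarrow> h m = S \<inter> (\<Inter>x\<in>X. h x)) \<and>
    (\<forall>X j. X \<subseteq> carrier P \<longrightarrow> |X| <o \<beta> \<longrightarrow> is_join P j X \<longrightarrow> h j = (\<Union>x\<in>X. h x))"

text \<open>
  HOL cannot quantify over the type of the points of \<open>S\<close>. Taking the points to be sets of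
  elements of \<open>P\<close> loses no generality: see \<open>representable_if_representation\<close>.
\<close>

definition representable :: "'c rel \<Rightarrow> 'd rel \<Rightarrow> ('a, 'r) gorder_scheme \<Rightarrow> bool"
  where "representable \<alpha> \<beta> P \<longleftrightarrow>
    (\<exists>(S :: 'a set set) h. representation \<alpha> \<beta> P S h)"

lemma representable_if_representation:
  fixes P :: "('a, 'r) gorder_scheme" and S :: "'s set" and h :: "'a \<Rightarrow> 's set"
  assumes rep: "representation \<alpha> \<beta> P S h"
  shows "representable \<alpha> \<beta> P"
proof -
  define k where "k s = {q \<in> carrier P. s \<in> h q}" for s
  define h' where "h' p = k ` h p" for p
  have into: "h p \<subseteq> S" if "p \<in> carrier P" for p
    using rep that unfolding representation_def by auto
  have mem: "k s \<in> h' p \<longleftrightarrow> s \<in> h p" if "p \<in> carrier P" for p s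
    using that unfolding h'_def k_def by blast
  have sub: "h' p \<subseteq> k ` S" if "p \<in> carrier P" for p
    using into[OF that] unfolding h'_def by blast
  have emb: "h' p \<subseteq> h' q \<longleftrightarrow> h p \<subseteq> h q" if "p \<in> carrier P" "q \<in> carrier P" for p q
    using mem[OF that(1)] mem[OF that(2)] unfolding h'_def by blast
  have wpo: "weak_partial_order (powerset_algebra T)" for T :: "'a set set"
    by unfold_locales auto
  have "representation \<alpha> \<beta> P (k ` S) h'"
    unfolding representation_def
  proof (intro conjI allI impI)
    show "h' \<in> carrier P \<rightarrow> Pow (k ` S)"
      using sub by blast
    show "order_emb P (powerset_algebra (k ` S)) h'"
      using rep wpo emb unfolding representation_def order_emb_def by simp
  next
    fix X m
    assume X: "X \<subseteq> carrier P" "|X| <o \<alpha>" "is_meet P m X"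
    then have m: "m \<in> carrier P"
      by (auto simp: greatest_def Lower_def)
    have hm: "h m = S \<inter> (\<Inter>x\<in>X. h x)"
      using rep X unfolding representation_def by blast
    show "h' m = k ` S \<inter> (\<Inter>x\<in>X. h' x)"
    proof
      show "h' m \<subseteq> k ` S \<inter> (\<Inter>x\<in>X. h' x)"
        using hm unfolding h'_def by blast
      show "k ` S \<inter> (\<Inter>x\<in>X. h' x) \<subseteq> h' m"
      proof
        fix t assume t: "t \<in> k ` S \<inter> (\<Inter>x\<in>X. h' x)"
        then obtain s where s: "s \<in> S" "t = k s"
          by blast
        then have "s \<in> h x" if "x \<in> X" for x
          using t mem[of x s] X(1) that by blast
        then show "t \<in> h' m"
          using s hm mem[OF m] by blast
      qed
    qed
  next
    fix X j
    assume X: "X \<subseteq> carrier P" "|X| <o \<beta>" "is_join P j X"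
    have "h j = (\<Union>x\<in>X. h x)"
      using rep X unfolding representation_def by blast
    then show "h' j = (\<Union>x\<in>X. h' x)"
      unfolding h'_def by blast
  qed
  then show ?thesis
    unfolding representable_def by blast
qed

end

theory Submission
  imports Defs
begin

text \<open>
  The points of the representation are ideals, a point \<open>I\<close> lying in the image of \<open>p\<close> iff \<open>p \<notin> I\<close>.
  An ideal is here a down-set closed under the existing joins of fewer than \<open>n\<close> elements; that
  closure is what makes joins go to unions. For finite meets to go to intersections, the complement
  of \<open>I\<close> must be closed under the existing finite meets, and for the map to be an order embedding
  such ideals must separate \<open>p\<close> from \<open>q\<close> whenever \<open>\<not> p \<le> q\<close>.

  The separating ideal is a maximal one among those that contain \<open>q\<close> and avoid \<open>p\<close>. Zorn's lemma
  gives it because \<open>n \<le> \<omega>\<close>: joins of finite sets are taken inside one member of a chain. That its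
  complement is closed under meets rests on the relative annihilators
  \<open>(I : a) = {z. every common lower bound of a and z is in I}\<close>. By \<open>MD\<close> these are ideals again
  (\<open>join_ideal_annihilator\<close>), although \<open>P\<close> may have few meets: \<open>MD\<close> is applied only
  to \<open>w \<and> \<Or>X\<close> with \<open>w \<le> \<Or>X\<close>, a meet that always exists. Now if \<open>w \<le> p\<close> and \<open>w \<notin> I\<close>, then
  \<open>(I : w)\<close> avoids \<open>p\<close>, so it equals \<open>I\<close> by maximality; hence any \<open>a \<notin> I\<close> has a common lower bound
  with \<open>w\<close> outside \<open>I\<close>. Repeating this from \<open>w = p\<close>, any finite set outside \<open>I\<close> has a lower
  bound outside \<open>I\<close>
  (\<open>lower_bound_outside_maximal_ideal\<close>), and so its meet is outside \<open>I\<close> too.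
\<close>

definition join_ideal :: "'c rel \<Rightarrow> ('a, 'r) gorder_scheme \<Rightarrow> 'a set \<Rightarrow> bool"
  where "join_ideal n P I \<longleftrightarrow> I \<subseteq> carrier P \<and>
    (\<forall>x\<in>I. \<forall>y\<in>carrier P. y \<sqsubseteq>\<^bsub>P\<^esub> x \<longrightarrow> y \<in> I) \<and>
    (\<forall>X j. X \<subseteq> I \<longrightarrow> |X| <o n \<longrightarrow> is_join P j X \<longrightarrow> j \<in> I)"

definition annihilator :: "('a, 'r) gorder_scheme \<Rightarrow> 'a set \<Rightarrow> 'a \<Rightarrow> 'a set"
  where "annihilator P I a =
    {z \<in> carrier P. \<forall>w\<in>carrier P. w \<sqsubseteq>\<^bsub>P\<^esub> a \<longrightarrow> w \<sqsubseteq>\<^bsub>P\<^esub> z \<longrightarrow> w \<in> I}"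

text \<open>
  The empty set counts as finite, so a top element is never in a meet-prime set; in particular
  a meet-prime ideal of a poset with a top is proper.
\<close>

definition meet_prime :: "('a, 'r) gorder_scheme \<Rightarrow> 'a set \<Rightarrow> bool"
  where "meet_prime P I \<longleftrightarrow>
    (\<forall>X m. X \<subseteq> carrier P - I \<longrightarrow> finite X \<longrightarrow> is_meet P m X \<longrightarrow> m \<notin> I)"

lemma join_idealI:
  assumes "I \<subseteq> carrier P"
    and "\<And>x y. x \<in> I \<Longrightarrow> y \<in> carrier P \<Longrightarrow> y \<sqsubseteq>\<^bsub>P\<^esub> x \<Longrightarrow> y \<in> I"
    and "\<And>X j. X \<subseteq> I \<Longrightarrow> |X| <o n \<Longrightarrow> is_join P j X \<Longrightarrow> j \<in> I"
  shows "join_ideal n P I"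
  using assms unfolding join_ideal_def by blast

lemma join_ideal_carrier: "join_ideal n P I \<Longrightarrow> x \<in> I \<Longrightarrow> x \<in> carrier P"
  unfolding join_ideal_def by blast

lemma join_ideal_down:
  "join_ideal n P I \<Longrightarrow> x \<in> I \<Longrightarrow> y \<in> carrier P \<Longrightarrow> y \<sqsubseteq>\<^bsub>P\<^esub> x \<Longrightarrow> y \<in> I"
  unfolding join_ideal_def by blast

lemma join_ideal_join:
  "join_ideal n P I \<Longrightarrow> X \<subseteq> I \<Longrightarrow> |X| <o n \<Longrightarrow> is_join P j X \<Longrightarrow> j \<in> I"
  unfolding join_ideal_def by blast

lemma is_joinD:
  assumes "is_join P j X"
  shows "j \<in> carrier P"
    and "X \<subseteq> carrier P \<Longrightarrow> x \<in> X \<Longrightarrow> x \<sqsubseteq>\<^bsub>P\<^esub> j"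
    and "b \<in> carrier P \<Longrightarrow> (\<And>x. x \<in> X \<Longrightarrow> x \<sqsubseteq>\<^bsub>P\<^esub> b) \<Longrightarrow> j \<sqsubseteq>\<^bsub>P\<^esub> b"
  using assms unfolding least_def Upper_def by blast+

lemma is_meetD:
  assumes "is_meet P m X"
  shows "m \<in> carrier P"
    and "X \<subseteq> carrier P \<Longrightarrow> x \<in> X \<Longrightarrow> m \<sqsubseteq>\<^bsub>P\<^esub> x"
    and "b \<in> carrier P \<Longrightarrow> (\<And>x. x \<in> X \<Longrightarrow> b \<sqsubseteq>\<^bsub>P\<^esub> x) \<Longrightarrow> b \<sqsubseteq>\<^bsub>P\<^esub> m"
  using assms unfolding greatest_def Lower_def by blast+

context partial_order
begin

lemma join_ideal_principal:
  assumes q: "q \<in> carrier L"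
  shows "join_ideal n L {z \<in> carrier L. z \<sqsubseteq> q}"
proof (rule join_idealI)
  show "j \<in> {z \<in> carrier L. z \<sqsubseteq> q}"
    if "X \<subseteq> {z \<in> carrier L. z \<sqsubseteq> q}" "is_join L j X" for X j
    using that(1) is_joinD(1)[OF that(2)] is_joinD(3)[OF that(2) q] by blast
  show "y \<in> {z \<in> carrier L. z \<sqsubseteq> q}"
    if "x \<in> {z \<in> carrier L. z \<sqsubseteq> q}" "y \<in> carrier L" "y \<sqsubseteq> x" for x y
    using that q le_trans[of y x q] by blast
qed blast

lemma join_ideal_subset_annihilator:
  assumes "join_ideal n L I"
  shows "I \<subseteq> annihilator L I a"
  using join_ideal_carrier[OF assms] join_ideal_down[OF assms] unfolding annihilator_def by blast

text \<open>
  Let \<open>w\<close> be a common lower bound of \<open>a\<close> and \<open>\<Or>X\<close>. Then \<open>w = w \<and> \<Or>X\<close>, which \<open>MD\<close> turns into the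
  join of the elements \<open>w \<and> x\<close>; each of these lies below \<open>a\<close> and \<open>x\<close>, hence in \<open>I\<close>.
\<close>

lemma join_ideal_annihilator:
  assumes MD: "MD n L" and I: "join_ideal n L I" and a: "a \<in> carrier L"
  shows "join_ideal n L (annihilator L I a)"
proof (rule join_idealI)
  show "annihilator L I a \<subseteq> carrier L"
    unfolding annihilator_def by blast
next
  fix x y assume "x \<in> annihilator L I a" "y \<in> carrier L" "y \<sqsubseteq> x"
  then show "y \<in> annihilator L I a"
    using le_trans[of _ y x] unfolding annihilator_def by blast
next
  fix X j
  assume X: "X \<subseteq> annihilator L I a" and small: "|X| <o n" and j: "is_join L j X"
  have Xc: "X \<subseteq> carrier L"
    using X unfolding annihilator_def by blast
  have jc: "j \<in> carrier L"
    using j by (rule is_joinD)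
  have "w \<in> I" if w: "w \<in> carrier L" "w \<sqsubseteq> a" "w \<sqsubseteq> j" for w
  proof -
    let ?M = "{c. \<exists>x\<in>X. is_meet L c {w, x}}"
    have "is_meet L w {w, j}"
      using w jc unfolding greatest_def Lower_def by auto
    then have ex: "\<forall>x\<in>X. \<exists>c. is_meet L c {w, x}" and join: "is_join L w ?M"
      using MD w(1) Xc small j unfolding MD_def by blast+
    have "?M \<subseteq> I"
    proof
      fix c assume "c \<in> ?M"
      then obtain x where x: "x \<in> X" and c: "is_meet L c {w, x}"
        by blast
      have xc: "x \<in> carrier L"
        using x Xc by blast
      have "c \<in> carrier L" "c \<sqsubseteq> w" "c \<sqsubseteq> x"
        using is_meetD(1)[OF c] is_meetD(2)[OF c] w(1) xc by auto
      moreover from this have "c \<sqsubseteq> a"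
        using le_trans[of c w a] w a by blast
      ultimately show "c \<in> I"
        using x X unfolding annihilator_def by blast
    qed
    \<comment> \<open>Meets are unique, so there are at most as many elements \<open>w \<and> x\<close> as there are \<open>x\<close>.\<close>
    moreover have "|?M| <o n"
    proof -
      have "c = (THE c. is_meet L c {w, x})" if "is_meet L c {w, x}" for c x
        using that greatest_unique by (intro the_equality[symmetric])
      then have "?M \<subseteq> (\<lambda>x. THE c. is_meet L c {w, x}) ` X"
        by blast
      then show ?thesis
        using small by (meson card_of_image card_of_mono1 ordLeq_ordLess_trans)
    qed
    ultimately show ?thesis
      using join_ideal_join[OF I] join by blast
  qed
  then show "j \<in> annihilator L I a"
    using jc unfolding annihilator_def by blast
qed

text \<open>
  This is where \<open>n \<le> \<omega>\<close> is needed: a finite subset of the union of a chain is contained in a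
  single member of the chain.
\<close>

lemma join_ideal_chain_Union:
  assumes n: "n \<le>o natLeq" and ideals: "\<And>I. I \<in> C \<Longrightarrow> join_ideal n L I"
    and chain: "subset.chain A C" and ne: "C \<noteq> {}"
  shows "join_ideal n L (\<Union>C)"
proof (rule join_idealI)
  show "\<Union>C \<subseteq> carrier L"
    using join_ideal_carrier[OF ideals] by blast
next
  fix x y assume "x \<in> \<Union>C" "y \<in> carrier L" "y \<sqsubseteq> x"
  then show "y \<in> \<Union>C"
    using join_ideal_down[OF ideals] by blast
next
  fix X j assume X: "X \<subseteq> \<Union>C" and small: "|X| <o n" and j: "is_join L j X"
  have "finite X"
    using ordLess_ordLeq_trans[OF small n] finite_iff_ordLess_natLeq by blast
  then obtain I where "I \<in> C" "X \<subseteq> I"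
    by (rule finite_subset_Union_chain[OF _ X ne chain])
  then show "j \<in> \<Union>C"
    using join_ideal_join[OF ideals _ small j] by blast
qed

text \<open>
  The bound \<open>w \<le> p\<close> is carried through the induction because it is what keeps \<open>p\<close> out of the
  annihilator of \<open>w\<close>, so that maximality applies to that annihilator in the next step.
\<close>

lemma lower_bound_outside_maximal_ideal:
  assumes MD: "MD n L" and I: "join_ideal n L I"
    and p: "p \<in> carrier L" "p \<notin> I"
    and maximal: "\<And>J. join_ideal n L J \<Longrightarrow> I \<subseteq> J \<Longrightarrow> p \<notin> J \<Longrightarrow> J = I"
    and B: "finite B" "B \<subseteq> carrier L - I"
  shows "\<exists>w\<in>carrier L - I. w \<sqsubseteq> p \<and> (\<forall>b\<in>B. w \<sqsubseteq> b)"
  using B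
proof (induction B)
  case empty
  then show ?case
    using p by auto
next
  case (insert a B)
  then obtain w where w: "w \<in> carrier L" "w \<notin> I" "w \<sqsubseteq> p" "\<forall>b\<in>B. w \<sqsubseteq> b"
    by auto
  have "p \<notin> annihilator L I w"
    using w unfolding annihilator_def by auto
  then have "annihilator L I w = I"
    using maximal join_ideal_annihilator[OF MD I w(1)] join_ideal_subset_annihilator[OF I] by blast
  then have "a \<notin> annihilator L I w"
    using insert.prems by blast
  then obtain v where v: "v \<in> carrier L" "v \<sqsubseteq> w" "v \<sqsubseteq> a" "v \<notin> I"
    using insert.prems unfolding annihilator_def by blast
  have "v \<sqsubseteq> p" "\<forall>b\<in>B. v \<sqsubseteq> b"
    using v w p insert.prems le_trans[of v w] by blast+
  then show ?case
    using v by blast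
qed

lemma meet_prime_ideal_separation:
  assumes n: "n \<le>o natLeq" and MD: "MD n L"
    and pq: "p \<in> carrier L" "q \<in> carrier L" "\<not> p \<sqsubseteq> q"
  shows "\<exists>I. join_ideal n L I \<and> meet_prime L I \<and> q \<in> I \<and> p \<notin> I"
proof -
  let ?A = "{I. join_ideal n L I \<and> q \<in> I \<and> p \<notin> I}"
  have "{z \<in> carrier L. z \<sqsubseteq> q} \<in> ?A"
    using pq join_ideal_principal[OF pq(2)] by auto
  then have "?A \<noteq> {}"
    by blast
  moreover have "\<Union>C \<in> ?A" if ne: "C \<noteq> {}" and chain: "subset.chain ?A C" for C
  proof -
    have C: "C \<subseteq> ?A"
      using chain by (simp add: subset_chain_def)
    then have "join_ideal n L (\<Union>C)"
      by (intro join_ideal_chain_Union[OF n _ chain ne]) blast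
    then show ?thesis
      using C ne by blast
  qed
  ultimately obtain I where I: "join_ideal n L I" "q \<in> I" "p \<notin> I"
    and "\<forall>J\<in>?A. I \<subseteq> J \<longrightarrow> J = I"
    using subset_Zorn_nonempty[of ?A] by blast
  then have maximal: "J = I" if "join_ideal n L J" "I \<subseteq> J" "p \<notin> J" for J
    using that by blast
  have "meet_prime L I"
    unfolding meet_prime_def
  proof (intro allI impI)
    fix X m assume X: "X \<subseteq> carrier L - I" "finite X" and m: "is_meet L m X"
    obtain w where "w \<in> carrier L - I" "\<forall>x\<in>X. w \<sqsubseteq> x"
      using lower_bound_outside_maximal_ideal[OF MD I(1) pq(1) I(3) maximal X(2,1)] by blast
    then show "m \<notin> I"
      using is_meetD(3)[OF m] join_ideal_down[OF I(1)] by blast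
  qed
  then show ?thesis
    using I by blast
qed

lemma representation_by_meet_prime_ideals:
  assumes n: "n \<le>o natLeq" and MD: "MD n L"
  defines "S \<equiv> {I. join_ideal n L I \<and> meet_prime L I}"
  shows "representation natLeq n L S (\<lambda>p. {I \<in> S. p \<notin> I})"
  unfolding representation_def
proof (intro conjI allI impI)
  show "(\<lambda>p. {I \<in> S. p \<notin> I}) \<in> carrier L \<rightarrow> Pow S"
    by blast
next
  have "weak_partial_order (powerset_algebra S)"
    by unfold_locales auto
  moreover have "{I \<in> S. p \<notin> I} \<subseteq> {I \<in> S. q \<notin> I} \<longleftrightarrow> p \<sqsubseteq> q"
    if "p \<in> carrier L" "q \<in> carrier L" for p q
    using that meet_prime_ideal_separation[OF n MD that] join_ideal_down[of n L _ q p]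
    unfolding S_def by blast
  ultimately show "order_emb L (powerset_algebra S) (\<lambda>p. {I \<in> S. p \<notin> I})"
    using weak_partial_order_axioms unfolding order_emb_def by simp
next
  fix X m assume X: "X \<subseteq> carrier L" "|X| <o natLeq" and m: "is_meet L m X"
  have "finite X"
    using X(2) finite_iff_ordLess_natLeq by blast
  then have "m \<notin> I \<longleftrightarrow> (\<forall>x\<in>X. x \<notin> I)" if "I \<in> S" for I
    using that X(1) m is_meetD(1,2)[OF m] join_ideal_down[of n L I _ m]
    unfolding S_def meet_prime_def by blast
  then show "{I \<in> S. m \<notin> I} = S \<inter> (\<Inter>x\<in>X. {I \<in> S. x \<notin> I})"
    by blast
next
  fix X j assume X: "X \<subseteq> carrier L" "|X| <o n" and j: "is_join L j X"
  have "j \<in> I \<longleftrightarrow> X \<subseteq> I" if "I \<in> S" for I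
    using that X j is_joinD(2)[OF j X(1)] join_ideal_down[of n L I j] join_ideal_join[of n L I X j]
    unfolding S_def by blast
  then show "{I \<in> S. j \<notin> I} = (\<Union>x\<in>X. {I \<in> S. x \<notin> I})"
    by blast
qed

end

theorem corollary4p6:
  fixes P :: "('a, 'r) gorder_scheme" and n :: "'c rel"
  assumes "Card_order n" and "|{..<3::nat}| \<le>o n" and "n \<le>o natLeq"
    and "partial_order P" and "MD n P"
  shows "representable natLeq n P"
  by (rule representable_if_representation)
    (rule partial_order.representation_by_meet_prime_ideals[OF assms(4,3,5)])

end
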